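(* For every positive integer $n$, $$eqdim(P_n)=n-r\left(\left\lceil \tfrac{n}{2}\right\rceil\right).$$
   Context: $P_n$ is the path with vertex set $[n]=\{1,\dots,n\}$ and edges $\{i,i+1\}$ for $i\in[n-1]$; $d(x,y)$ denotes the graph distance. A set $S\subseteq V(G)$ of vertices of a connected graph $G$ is a distance-equalizer set of $G$ if for every two distinct vertices $x,y\in V(G)\setminus S$ there is $w\in S$ with $d(x,w)=d(y,w)$. The equidistant dimension $eqdim(G)$ is the minimum cardinality of a distance-equalizer set of $G$. A set $T\subseteq[m]$ is 3-AP-free if $a+c\ne 2b$ for all distinct $a,b,c\in T$; $r(m)$ denotes the largest cardinality of a 3-AP-free subset of $[m]$. *)

theory Defs
  imports "Graph_Theory.Graph_Theory"
begin

text \<open>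
  A finite simple graph is an instance of the locale \<^locale>\<open>graph\<close>: a finite, loop-free symmetric
  digraph without parallel arcs, in which an undirected edge is a pair of opposite arcs.
\<close>

definition path_graph :: "nat \<Rightarrow> (nat, nat \<times> nat) pre_digraph" where
  "path_graph n = with_proj
     \<lparr> pverts = {1..n}, parcs = (\<Union>i\<in>{1..n - 1}. {(i, i + 1), (i + 1, i)}) \<rparr>"

text \<open>Shortest-path cost with unit weights; the value is \<open>\<infinity>\<close> for vertices in different components.\<close>

definition graph_dist :: "('a, 'b) pre_digraph \<Rightarrow> 'a \<Rightarrow> 'a \<Rightarrow> ereal" where
  "graph_dist G x y = wf_digraph.\<mu> G (\<lambda>_. 1) x y"

definition distance_equalizer :: "('a, 'b) pre_digraph \<Rightarrow> 'a set \<Rightarrow> bool" where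
  "distance_equalizer G S \<longleftrightarrow> S \<subseteq> verts G \<and>
     (\<forall>x \<in> verts G - S. \<forall>y \<in> verts G - S. x \<noteq> y \<longrightarrow>
        (\<exists>w \<in> S. graph_dist G x w = graph_dist G y w))"

definition eqdim :: "('a, 'b) pre_digraph \<Rightarrow> nat" where
  "eqdim G = (LEAST k. \<exists>S. distance_equalizer G S \<and> finite S \<and> card S = k)"

definition ap3_free :: "nat set \<Rightarrow> bool" where
  "ap3_free T \<longleftrightarrow>
     (\<forall>a\<in>T. \<forall>b\<in>T. \<forall>c\<in>T. a \<noteq> b \<and> b \<noteq> c \<and> a \<noteq> c \<longrightarrow> a + c \<noteq> 2 * b)"

definition ap3_free_max :: "nat \<Rightarrow> nat" where
  "ap3_free_max m = Max (card ` {T. T \<subseteq> {1..m} \<and> ap3_free T})"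

lemma graph_path_graph: "graph (path_graph n)"
  by unfold_locales
    (auto simp: path_graph_def with_proj_def arc_to_ends_def symmetric_def arcs_ends_def sym_def)

lemma path_graph_reachable_1:
  assumes "x \<in> {1..n}"
  shows "1 \<rightarrow>\<^sup>*\<^bsub>path_graph n\<^esub> x"
proof -
  interpret graph "path_graph n" by (rule graph_path_graph)
  from assms have "1 \<le> x" "x \<le> n" by auto
  then show ?thesis
  proof (induction x rule: dec_induct)
    case base
    then have "1 \<in> verts (path_graph n)" by (simp add: path_graph_def)
    then show ?case by (rule reachable_refl)
  next
    case (step k)
    then have "(k, k + 1) \<in> arcs_ends (path_graph n)"
      by (auto simp: path_graph_def intro!: bexI[of _ k])
    with step show ?case by (auto intro: reachable_adj_trans)
  qed
qed

lemma connected_path_graph: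
  assumes "n \<ge> 1"
  shows "connected (path_graph n)"
proof -
  interpret graph "path_graph n" by (rule graph_path_graph)
  have "x \<rightarrow>\<^sup>*\<^bsub>path_graph n\<^esub> y" if "x \<in> {1..n}" "y \<in> {1..n}" for x y
    using that path_graph_reachable_1 symmetric_reachable[OF sym_arcs] reachable_trans by blast
  moreover have "verts (path_graph n) = {1..n}" by (simp add: path_graph_def)
  ultimately show ?thesis
    using assms by (simp add: connected_def strongly_connected_def reachable_mk_symmetricI)
qed

end

theory Submission
  imports Defs
begin

text \<open>
  On the path \<open>P\<^sub>n\<close> the distance is \<open>\<bar>x - y\<bar>\<close>, so a vertex equidistant from two distinct vertices
  \<open>x\<close> and \<open>y\<close> must be their midpoint \<open>(x + y) / 2\<close>. Hence \<open>S\<close> is a distance-equalizer set exactly when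
  its complement \<open>T\<close> satisfies two conditions: any two elements of \<open>T\<close> have the same parity (so that
  the midpoint is a vertex), and no midpoint of two distinct elements of \<open>T\<close> lies in \<open>T\<close> (so that it is in \<open>S\<close>),
  which means that \<open>T\<close> is 3-AP-free (\<open>distance_equalizer_path_iff\<close>).

  Minimising \<open>S\<close> is maximising such a \<open>T\<close>. The odd numbers in \<open>[n]\<close> form an arithmetic progression
  with \<open>\<lceil>n/2\<rceil>\<close> terms, and the even ones a progression with \<open>\<lfloor>n/2\<rfloor>\<close> terms. Rescaling a progression to
  an initial segment preserves and reflects the relation \<open>a + c = 2 b\<close>, and therefore 3-AP-freeness and
  cardinality (\<open>ap3_free_image\<close>, \<open>inj_on_if_reflects_ap3\<close>). So the best odd \<open>T\<close>
  has \<open>r(\<lceil>n/2\<rceil>)\<close> elements, and an even \<open>T\<close> rescales into \<open>[\<lfloor>n/2\<rfloor>] \<subseteq> [\<lceil>n/2\<rceil>]\<close> and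
  cannot be larger.
\<close>

section \<open>Distances in the path\<close>

lemma verts_path_graph: "verts (path_graph n) = {1..n}"
  by (simp add: path_graph_def)

lemma arcs_path_graph_iff:
  "(u, v) \<in> arcs (path_graph n) \<longleftrightarrow> u \<in> {1..n} \<and> v \<in> {1..n} \<and> (v = u + 1 \<or> u = v + 1)"
  by (auto simp: path_graph_def)

lemma tail_path_graph: "tail (path_graph n) = fst"
  and head_path_graph: "head (path_graph n) = snd"
  by (simp_all add: path_graph_def)

text \<open>Every arc changes the vertex number by exactly one.\<close>

lemma awalk_path_graph_cost_ge:
  assumes "pre_digraph.awalk (path_graph n) x p y"
  shows "\<bar>real x - real y\<bar> \<le> wf_digraph.awalk_cost (\<lambda>_. 1) p"
proof -
  interpret graph "path_graph n" by (rule graph_path_graph)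
  show ?thesis
    using assms
  proof (induction p arbitrary: x)
    case Nil
    then show ?case by (simp add: awalk_Nil_iff)
  next
    case (Cons e p)
    obtain u v where e: "e = (u, v)" by (cases e)
    from Cons.prems have arc: "(u, v) \<in> arcs (path_graph n)" and "u = x" and p: "awalk v p y"
      by (auto simp: awalk_Cons_iff e tail_path_graph head_path_graph)
    then have "\<bar>real x - real v\<bar> = 1"
      by (auto simp: arcs_path_graph_iff)
    with Cons.IH[OF p] show ?case by simp
  qed
qed

text \<open>The walk that steps towards \<open>y\<close> all the time attains the bound.\<close>

lemma awalk_path_graph_exists:
  assumes "x \<in> {1..n}" "y \<in> {1..n}"
  shows "\<exists>p. pre_digraph.awalk (path_graph n) x p y \<and>
    wf_digraph.awalk_cost (\<lambda>_. 1) p = \<bar>real x - real y\<bar>"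
proof -
  interpret graph "path_graph n" by (rule graph_path_graph)
  show ?thesis
    using assms
  proof (induction "nat \<bar>int x - int y\<bar>" arbitrary: x)
    case 0
    then have "awalk x [] y" and "x = y" by (auto simp: awalk_Nil_iff verts_path_graph)
    then show ?case by (intro exI[of _ "[]"]) (simp add:)
  next
    case (Suc d)
    define z where "z = (if x < y then x + 1 else x - 1)"
    have z: "z \<in> {1..n}" "d = nat \<bar>int z - int y\<bar>" "z = x + 1 \<or> x = z + 1"
      and closer: "\<bar>real x - real y\<bar> = 1 + \<bar>real z - real y\<bar>"
    proof -
      from Suc.hyps(2) have "x \<noteq> y" by auto
      with Suc.hyps(2) Suc.prems show "z \<in> {1..n}" "d = nat \<bar>int z - int y\<bar>"
          "z = x + 1 \<or> x = z + 1" "\<bar>real x - real y\<bar> = 1 + \<bar>real z - real y\<bar>"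
        unfolding z_def atLeastAtMost_iff by (cases "x < y"; simp; linarith)+
    qed
    from Suc.hyps(1)[OF z(2,1) Suc.prems(2)] obtain p
      where p: "awalk z p y" "awalk_cost (\<lambda>_. 1) p = \<bar>real z - real y\<bar>" by blast
    have "(x, z) \<in> arcs (path_graph n)"
      using Suc.prems z by (simp add: arcs_path_graph_iff)
    with p have "awalk x ((x, z) # p) y"
      using Suc.prems by (simp add: awalk_Cons_iff tail_path_graph head_path_graph)
    with p closer show ?case by (intro exI[of _ "(x, z) # p"]) simp
  qed
qed

lemma graph_dist_path:
  assumes "x \<in> {1..n}" "y \<in> {1..n}"
  shows "graph_dist (path_graph n) x y = ereal \<bar>real x - real y\<bar>"
proof -
  interpret graph "path_graph n" by (rule graph_path_graph)
  obtain p where "awalk x p y" "awalk_cost (\<lambda>_. 1) p = \<bar>real x - real y\<bar>"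
    using awalk_path_graph_exists[OF assms] by blast
  then have "\<mu> (\<lambda>_. 1) x y \<le> ereal \<bar>real x - real y\<bar>"
    by (metis min_cost_le_walk_cost)
  moreover have "ereal \<bar>real x - real y\<bar> \<le> \<mu> (\<lambda>_. 1) x y"
    unfolding \<mu>_def by (rule INF_greatest) (simp add: awalk_path_graph_cost_ge)
  ultimately show ?thesis
    unfolding graph_dist_def by (rule antisym)
qed

section \<open>Distance-equalizer sets of the path\<close>

lemma equidistant_in_path_iff_midpoint:
  assumes "x \<in> {1..n}" "y \<in> {1..n}" "w \<in> {1..n}" "x \<noteq> y"
  shows "graph_dist (path_graph n) x w = graph_dist (path_graph n) y w \<longleftrightarrow> x + y = 2 * w"
  using assms by (simp add: graph_dist_path) linarith

lemma distance_equalizer_path_iff: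
  assumes "T \<subseteq> {1..n}"
  shows "distance_equalizer (path_graph n) ({1..n} - T) \<longleftrightarrow>
    (\<forall>x\<in>T. \<forall>y\<in>T. even (x + y)) \<and> ap3_free T"
proof -
  have midpoints: "distance_equalizer (path_graph n) ({1..n} - T) \<longleftrightarrow>
      (\<forall>x\<in>T. \<forall>y\<in>T. x \<noteq> y \<longrightarrow> (\<exists>w\<in>{1..n} - T. x + y = 2 * w))"
  proof -
    have "{1..n} - ({1..n} - T) = T" using assms by blast
    moreover have "(\<exists>w\<in>{1..n} - T. graph_dist (path_graph n) x w = graph_dist (path_graph n) y w)
        \<longleftrightarrow> (\<exists>w\<in>{1..n} - T. x + y = 2 * w)" if "x \<in> T" "y \<in> T" "x \<noteq> y" for x y
      using that assms by (intro bex_cong refl equidistant_in_path_iff_midpoint) auto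
    ultimately show ?thesis
      unfolding distance_equalizer_def verts_path_graph by auto
  qed
  show ?thesis
  proof (intro iffI conjI ballI)
    fix x y
    assume "distance_equalizer (path_graph n) ({1..n} - T)" "x \<in> T" "y \<in> T"
    then show "even (x + y)"
      unfolding midpoints by (cases "x = y") fastforce+
  next
    assume "distance_equalizer (path_graph n) ({1..n} - T)"
    then show "ap3_free T"
      unfolding midpoints ap3_free_def by fastforce
  next
    assume *: "(\<forall>x\<in>T. \<forall>y\<in>T. even (x + y)) \<and> ap3_free T"
    have "\<exists>w\<in>{1..n} - T. x + y = 2 * w" if "x \<in> T" "y \<in> T" "x \<noteq> y" for x y
    proof -
      from * that obtain w where w: "x + y = 2 * w" by blast
      then have "w \<noteq> x" "w \<noteq> y" using that by auto
      with * that w have "w \<notin> T" unfolding ap3_free_def by metis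
      moreover from assms that have "x \<in> {1..n}" "y \<in> {1..n}" by auto
      with w have "w \<in> {1..n}" by auto
      ultimately show ?thesis using w by blast
    qed
    then show "distance_equalizer (path_graph n) ({1..n} - T)"
      unfolding midpoints by blast
  qed
qed

section \<open>Rescaling 3-AP-free sets\<close>

text \<open>
  Taking \<open>c = b\<close> in the relation \<open>a + c = 2 b\<close> turns it into \<open>a = b\<close>, so a map that reflects the
  relation is injective.
\<close>

lemma inj_on_if_reflects_ap3:
  fixes f :: "nat \<Rightarrow> nat"
  assumes "\<And>a b c. a \<in> T \<Longrightarrow> b \<in> T \<Longrightarrow> c \<in> T \<Longrightarrow> f a + f c = 2 * f b \<Longrightarrow> a + c = 2 * b"
  shows "inj_on f T"
proof (rule inj_onI)
  fix a b assume "a \<in> T" "b \<in> T" "f a = f b"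
  with assms[of a b b] show "a = b" by simp
qed

lemma ap3_free_image:
  fixes f :: "nat \<Rightarrow> nat"
  assumes "ap3_free T"
    and "\<And>a b c. a \<in> T \<Longrightarrow> b \<in> T \<Longrightarrow> c \<in> T \<Longrightarrow> f a + f c = 2 * f b \<Longrightarrow> a + c = 2 * b"
  shows "ap3_free (f ` T)"
  unfolding ap3_free_def
proof (intro ballI impI notI)
  fix u v w
  assume "u \<in> f ` T" "v \<in> f ` T" "w \<in> f ` T" and uvw: "u \<noteq> v \<and> v \<noteq> w \<and> u \<noteq> w" "u + w = 2 * v"
  then obtain a b c where abc: "a \<in> T" "b \<in> T" "c \<in> T" "u = f a" "v = f b" "w = f c" by blast
  then have "a + c = 2 * b" using assms(2) uvw(2) by blast
  moreover have "a \<noteq> b" "b \<noteq> c" "a \<noteq> c" using abc uvw(1) by auto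
  ultimately show False using assms(1) abc(1-3) unfolding ap3_free_def by blast
qed

lemma ap3_free_max_ge:
  assumes "T \<subseteq> {1..m}" "ap3_free T"
  shows "card T \<le> ap3_free_max m"
  unfolding ap3_free_max_def
  by (rule Max_ge) (use assms in auto)

lemma ap3_free_max_attained:
  obtains T where "T \<subseteq> {1..m}" "ap3_free T" "card T = ap3_free_max m"
proof -
  have "ap3_free_max m \<in> card ` {T. T \<subseteq> {1..m} \<and> ap3_free T}"
    unfolding ap3_free_max_def
  proof (rule Max_in)
    have "ap3_free {}" by (simp add: ap3_free_def)
    then show "card ` {T. T \<subseteq> {1..m} \<and> ap3_free T} \<noteq> {}" by blast
  qed simp
  then show ?thesis using that by auto
qed

text \<open>
  The map \<open>x \<mapsto> \<lceil>x/2\<rceil>\<close> sends \<open>2 t - 1\<close> as well as \<open>2 t\<close> to \<open>t\<close>, so it rescales the odd and the even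
  numbers at once: on each parity class it is affine, and so it reflects \<open>a + c = 2 b\<close> there. It does not
  do so across the classes, which is why all elements of \<open>T\<close> must have the same parity.
\<close>

lemma card_ap3_free_same_parity_le:
  assumes "T \<subseteq> {1..n}" "\<forall>x\<in>T. \<forall>y\<in>T. even (x + y)" "ap3_free T"
  shows "card T \<le> ap3_free_max ((n + 1) div 2)"
proof -
  define f :: "nat \<Rightarrow> nat" where "f x = (x + 1) div 2" for x
  have reflects: "a + c = 2 * b"
    if "a \<in> T" "b \<in> T" "c \<in> T" "f a + f c = 2 * f b" for a b c
  proof -
    have "even (a + b)" "even (b + c)" using assms(2) that by blast+
    then have "(a + 1) mod 2 = (b + 1) mod 2" "(c + 1) mod 2 = (b + 1) mod 2"
      by (simp_all add: mod2_eq_if)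
    moreover have f: "2 * f x + (x + 1) mod 2 = x + 1" for x by (simp add: f_def)
    ultimately show ?thesis using that(4) f[of a] f[of b] f[of c] by linarith
  qed
  have "1 \<le> f x \<and> f x \<le> (n + 1) div 2" if "x \<in> T" for x
  proof -
    have "1 \<le> x" "x \<le> n" using assms(1) that by auto
    then show ?thesis unfolding f_def by linarith
  qed
  then have "f ` T \<subseteq> {1..(n + 1) div 2}" by auto
  then have "card (f ` T) \<le> ap3_free_max ((n + 1) div 2)"
    using ap3_free_image[OF assms(3) reflects] by (rule ap3_free_max_ge)
  then show ?thesis
    using card_image[OF inj_on_if_reflects_ap3[OF reflects]] by simp
qed

lemma ap3_free_odd_set_exists:
  obtains T where "T \<subseteq> {1..n}" "\<forall>x\<in>T. odd x" "ap3_free T"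
    "card T = ap3_free_max ((n + 1) div 2)"
proof -
  obtain T where T: "T \<subseteq> {1..(n + 1) div 2}" "ap3_free T"
      "card T = ap3_free_max ((n + 1) div 2)"
    by (rule ap3_free_max_attained)
  define g :: "nat \<Rightarrow> nat" where "g t = 2 * t - 1" for t
  have reflects: "a + c = 2 * b"
    if "a \<in> T" "b \<in> T" "c \<in> T" "g a + g c = 2 * g b" for a b c
  proof -
    have "a \<ge> 1" "b \<ge> 1" "c \<ge> 1" using T(1) that by auto
    with that(4) show ?thesis unfolding g_def by linarith
  qed
  show ?thesis
  proof
    have "1 \<le> g t \<and> g t \<le> n" if "t \<in> T" for t
    proof -
      have "1 \<le> t" "t \<le> (n + 1) div 2" using T(1) that by auto
      then show ?thesis unfolding g_def by linarith
    qed
    then show "g ` T \<subseteq> {1..n}" by auto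
    show "\<forall>x\<in>g ` T. odd x" using T(1) by (auto simp: g_def)
    show "ap3_free (g ` T)" using T(2) reflects by (rule ap3_free_image)
    show "card (g ` T) = ap3_free_max ((n + 1) div 2)"
      using card_image[OF inj_on_if_reflects_ap3[OF reflects]] T(3) by simp
  qed
qed

section \<open>The equidistant dimension of the path\<close>

theorem theorem13:
  fixes n :: nat
  assumes "n \<ge> 1"
  shows "int (eqdim (path_graph n)) = int n - int (ap3_free_max (nat \<lceil>real n / 2\<rceil>))"
proof -
  let ?r = "ap3_free_max ((n + 1) div 2)"
  have half: "nat \<lceil>real n / 2\<rceil> = (n + 1) div 2" by linarith
  obtain T where T: "T \<subseteq> {1..n}" "\<forall>x\<in>T. odd x" "ap3_free T" "card T = ?r"
    by (rule ap3_free_odd_set_exists)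
  have "eqdim (path_graph n) = n - ?r"
    unfolding eqdim_def
  proof (rule Least_equality)
    have "distance_equalizer (path_graph n) ({1..n} - T)"
      unfolding distance_equalizer_path_iff[OF T(1)] using T(2,3) by simp
    moreover have "card ({1..n} - T) = n - ?r"
      using T by (simp add: card_Diff_subset finite_subset)
    ultimately show "\<exists>S. distance_equalizer (path_graph n) S \<and> finite S \<and> card S = n - ?r"
      by blast
  next
    fix k
    assume "\<exists>S. distance_equalizer (path_graph n) S \<and> finite S \<and> card S = k"
    then obtain S where S: "distance_equalizer (path_graph n) S" "card S = k" by blast
    define U where "U = {1..n} - S"
    have "S \<subseteq> {1..n}"
      using S(1) by (simp add: distance_equalizer_def verts_path_graph)
    then have S_eq: "S = {1..n} - U" and "U \<subseteq> {1..n}" by (auto simp: U_def)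
    have "(\<forall>x\<in>U. \<forall>y\<in>U. even (x + y)) \<and> ap3_free U"
      using S(1) unfolding S_eq distance_equalizer_path_iff[OF \<open>U \<subseteq> {1..n}\<close>] .
    with \<open>U \<subseteq> {1..n}\<close> have "card U \<le> ?r" by (blast intro: card_ap3_free_same_parity_le)
    moreover have "k = n - card U"
      using S(2) S_eq \<open>U \<subseteq> {1..n}\<close> by (simp add: card_Diff_subset finite_subset)
    ultimately show "n - ?r \<le> k" by simp
  qed
  moreover have "?r \<le> n"
    using card_mono[OF _ T(1)] T(4) by simp
  ultimately show ?thesis by (simp add: half)
qed

end
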